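(* Let $\mathbb{I}$ be a discrete interval unbounded below, $(X,d)$ a complete metric space, $U_t\subseteq X$ ($t\in\mathbb{I}$) nonempty closed sets, and for each $n\in\mathbb{N}_0$ let $\mathscr{F}_t^n:U_t\to X$, $t\in\mathbb{I}'$, be continuous with $\mathscr{F}_t^n(U_t)\subseteq U_{t+1}$. Let $\varphi^n$ be the general solution of the difference equation $(\Delta_n)$: $u_{t+1}=\mathscr{F}_t^n(u_t)$. If each $(\Delta_n)$, $n\in\mathbb{N}_0$, has a pullback attractor $\mathcal{A}_n^\ast$ and (i) $\bigcup_{n\in\mathbb{N}_0}\mathcal{A}_n^\ast(\tau)$ is relatively compact for every $\tau\in\mathbb{I}$, (ii) $\bigcup_{n\in\mathbb{N}_0}\bigcup_{s\le\tau}\mathcal{A}_n^\ast(s)$ is bounded for every $\tau\in\mathbb{I}$, (iii) for all $\varepsilon>0$, $S\in\mathbb{N}$ and every compact $K\subseteq X$ there exists an $n_0\in\mathbb{N}$ such that for all $\tau\in\mathbb{I}$ and all $n>n_0$ one has $$\max_{0<s\le S}\ \sup_{u\in U_{\tau-s}\cap K}d\bigl(\varphi^n(\tau;\tau-s,u),\varphi^0(\tau;\tau-s,u)\bigr)<\varepsilon$$ hold, then $\lim_{n\to\infty}\max_{t\in I}\operatorname{dist}(\mathcal{A}_n^\ast(t),\mathcal{A}_0^\ast(t))=0$ for every bounded $I\subseteq\mathbb{I}$.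
   Context: A discrete interval is the intersection of a real interval with $\mathbb{Z}$; $\mathbb{I}':=\{t\in\mathbb{I}:t+1\in\mathbb{I}\}$; $\mathbb{N}=\{1,2,\dots\}$, $\mathbb{N}_0=\{0,1,2,\dots\}$; $s$ denotes integers. The general solution is $\varphi^n(\tau;\tau,u)=u$ and $\varphi^n(t;\tau,u)=\mathscr{F}^n_{t-1}\circ\cdots\circ\mathscr{F}^n_\tau(u)$ for $\tau<t$, $u\in U_\tau$. Put $\mathcal{U}:=\{(t,u)\in\mathbb{I}\times X:u\in U_t\}$. A nonautonomous set $\mathcal{A}\subseteq\mathcal{U}$ has nonempty fibers $\mathcal{A}(t)=\{x:(t,x)\in\mathcal{A}\}$, $t\in\mathbb{I}$; it is compact if every fiber is compact; bounded if there are $R>0$, $x_0\in X$ with $\mathcal{A}(t)\subseteq B_R(x_0)$ for all $t\in\mathbb{I}$; invariant for $(\Delta_n)$ if $\mathscr{F}^n_t(\mathcal{A}(t))=\mathcal{A}(t+1)$ for all $t\in\mathbb{I}'$. The Hausdorff semidistance is $\operatorname{dist}(A,B)=\sup_{a\in A}\inf_{b\in B}d(a,b)$. A pullback attractor $\mathcal{A}_n^\ast\subseteq\mathcal{U}$ of $(\Delta_n)$ is a compact and invariant nonautonomous set such that $\lim_{s\to\infty}\operatorname{dist}(\varphi^n(\tau;\tau-s,\mathcal{B}(\tau-s)),\mathcal{A}_n^\ast(\tau))=0$ for all $\tau\in\mathbb{I}$ and all bounded nonautonomous sets $\mathcal{B}\subseteq\mathcal{U}$.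
   Formalization: The bounded sets B that a pullback attractor must attract may have empty fibers; this differs only if no bounded nonautonomous set exists, when attraction is vacuous and the claim as stated fails. *)

theory Defs
  imports "HOL-Analysis.Analysis"
begin

definition discrete_interval :: "int set \<Rightarrow> bool" where
  "discrete_interval I \<longleftrightarrow>
     (\<exists>J :: real set. is_interval J \<and> I = {t. real_of_int t \<in> J})"

text \<open>The times \<open>t\<close> at which the right-hand side acts, usually denoted by \<open>I'\<close>.\<close>

definition shifted :: "int set \<Rightarrow> int set" where
  "shifted I = {t \<in> I. t + 1 \<in> I}"

text \<open>
  \<open>fold F [\<tau>..t - 1]\<close> is the composition of \<open>F (t - 1), \<dots>, F \<tau>\<close> with \<open>F \<tau>\<close> applied first, and
  the identity for \<open>t = \<tau>\<close>. Only \<open>\<tau> \<le> t\<close> is meaningful.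
\<close>

definition general_solution :: "(int \<Rightarrow> 'a \<Rightarrow> 'a) \<Rightarrow> int \<Rightarrow> int \<Rightarrow> 'a \<Rightarrow> 'a" where
  "general_solution F t \<tau> u = fold F [\<tau>..t - 1] u"

definition fiber :: "(int \<times> 'a) set \<Rightarrow> int \<Rightarrow> 'a set" where
  "fiber A t = {x. (t, x) \<in> A}"

text \<open>\<open>Sigma I U\<close> is the extended state space of all \<open>(t, u)\<close> with \<open>t \<in> I\<close> and \<open>u \<in> U t\<close>.\<close>

definition nonautonomous_set :: "int set \<Rightarrow> (int \<Rightarrow> 'a set) \<Rightarrow> (int \<times> 'a) set \<Rightarrow> bool" where
  "nonautonomous_set I U A \<longleftrightarrow> A \<subseteq> Sigma I U \<and> (\<forall>t\<in>I. fiber A t \<noteq> {})"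

definition na_compact :: "int set \<Rightarrow> (int \<times> 'a::metric_space) set \<Rightarrow> bool" where
  "na_compact I A \<longleftrightarrow> (\<forall>t\<in>I. compact (fiber A t))"

definition na_bounded :: "int set \<Rightarrow> (int \<times> 'a::metric_space) set \<Rightarrow> bool" where
  "na_bounded I A \<longleftrightarrow> (\<exists>R>0. \<exists>x0. \<forall>t\<in>I. fiber A t \<subseteq> ball x0 R)"

definition na_invariant :: "int set \<Rightarrow> (int \<Rightarrow> 'a \<Rightarrow> 'a) \<Rightarrow> (int \<times> 'a) set \<Rightarrow> bool" where
  "na_invariant I F A \<longleftrightarrow> (\<forall>t\<in>shifted I. F t ` fiber A t = fiber A (t + 1))"

text \<open>Taken in \<open>[0, \<infinity>]\<close>, so that suprema of unbounded sets are infinite and the empty one is 0.\<close>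

definition semidist :: "'a::metric_space set \<Rightarrow> 'a set \<Rightarrow> ennreal" where
  "semidist A B = (SUP a\<in>A. INF b\<in>B. ennreal (dist a b))"

definition pullback_attracts ::
  "int set \<Rightarrow> (int \<Rightarrow> 'a::metric_space \<Rightarrow> 'a) \<Rightarrow> (int \<times> 'a) set \<Rightarrow> (int \<times> 'a) set \<Rightarrow> bool" where
  "pullback_attracts I F A B \<longleftrightarrow>
     (\<forall>\<tau>\<in>I. ((\<lambda>s::int. semidist (general_solution F \<tau> (\<tau> - s) ` fiber B (\<tau> - s)) (fiber A \<tau>))
               \<longlongrightarrow> 0) at_top)"

text \<open>
  The attracted sets \<open>B\<close> are all bounded subsets of the extended state space; unlike for the
  attractor itself, some of their fibers may be empty (an empty fiber has an empty image, at
  semidistance 0). This matters only if there is no bounded \<open>B\<close> with all fibers nonempty at all,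
  which can happen when the sets \<open>U t\<close> leave every ball as \<open>t\<close> grows. Insisting on nonempty fibers,
  attraction would then be vacuous and every compact invariant nonautonomous set an attractor, for
  which upper semicontinuity fails. In all other cases the two readings agree, see
  \<open>pullback_attractor_iff_nonempty_fibers\<close>.
\<close>

definition pullback_attractor ::
  "int set \<Rightarrow> (int \<Rightarrow> 'a::metric_space set) \<Rightarrow> (int \<Rightarrow> 'a \<Rightarrow> 'a) \<Rightarrow> (int \<times> 'a) set \<Rightarrow> bool" where
  "pullback_attractor I U F A \<longleftrightarrow>
     nonautonomous_set I U A \<and> na_compact I A \<and> na_invariant I F A \<and>
     (\<forall>B. B \<subseteq> Sigma I U \<and> na_bounded I B \<longrightarrow> pullback_attracts I F A B)"

lemma semidist_mono: "A \<subseteq> A' \<Longrightarrow> semidist A B \<le> semidist A' B"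
  unfolding semidist_def by (rule SUP_subset_mono) auto

lemma pullback_attracts_mono:
  assumes "pullback_attracts I F A B'" "B \<subseteq> B'"
  shows "pullback_attracts I F A B"
  unfolding pullback_attracts_def
proof
  fix \<tau> assume "\<tau> \<in> I"
  then have lim: "((\<lambda>s::int. semidist (general_solution F \<tau> (\<tau> - s) ` fiber B' (\<tau> - s)) (fiber A \<tau>))
      \<longlongrightarrow> 0) at_top"
    using assms(1) by (simp add: pullback_attracts_def)
  show "((\<lambda>s::int. semidist (general_solution F \<tau> (\<tau> - s) ` fiber B (\<tau> - s)) (fiber A \<tau>))
      \<longlongrightarrow> 0) at_top"
    by (rule tendsto_sandwich[OF _ _ tendsto_const lim])
       (use assms(2) in \<open>auto intro!: always_eventually semidist_mono simp: fiber_def\<close>)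
qed

lemma na_bounded_Un:
  assumes "na_bounded I B" "na_bounded I C"
  shows "na_bounded I (B \<union> C)"
proof -
  obtain R x r y where R: "R > 0" "\<forall>t\<in>I. fiber B t \<subseteq> ball x R"
    and r: "r > 0" "\<forall>t\<in>I. fiber C t \<subseteq> ball y r"
    using assms unfolding na_bounded_def by blast
  have "ball y r \<subseteq> ball x (R + r + dist x y)"
  proof
    fix z assume "z \<in> ball y r"
    then show "z \<in> ball x (R + r + dist x y)"
      using R(1) dist_triangle[of x z y] by simp
  qed
  moreover have "ball x R \<subseteq> ball x (R + r + dist x y)"
    using r(1) by (intro subset_ball) (simp add: add_nonneg_nonneg)
  moreover have "fiber (B \<union> C) t = fiber B t \<union> fiber C t" for t
    by (auto simp: fiber_def)
  ultimately have "\<forall>t\<in>I. fiber (B \<union> C) t \<subseteq> ball x (R + r + dist x y)"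
    using R(2) r(2) by blast
  moreover have "R + r + dist x y > 0"
    using R(1) r(1) by (simp add: add_pos_nonneg)
  ultimately show ?thesis
    unfolding na_bounded_def by blast
qed

lemma pullback_attractor_iff_nonempty_fibers:
  assumes "nonautonomous_set I U C" "na_bounded I C"
  shows "pullback_attractor I U F A \<longleftrightarrow>
     nonautonomous_set I U A \<and> na_compact I A \<and> na_invariant I F A \<and>
     (\<forall>B. nonautonomous_set I U B \<and> na_bounded I B \<longrightarrow> pullback_attracts I F A B)"
    (is "_ \<longleftrightarrow> ?R")
proof
  assume "pullback_attractor I U F A"
  then show ?R
    by (simp add: pullback_attractor_def nonautonomous_set_def)
next
  assume R: ?R
  have "pullback_attracts I F A B" if "B \<subseteq> Sigma I U" "na_bounded I B" for B
  proof -
    have "nonautonomous_set I U (B \<union> C)"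
      using assms(1) that(1) by (auto simp: nonautonomous_set_def fiber_def)
    then have "pullback_attracts I F A (B \<union> C)"
      using R na_bounded_Un[OF that(2) assms(2)] by blast
    then show ?thesis
      by (rule pullback_attracts_mono) simp
  qed
  with R show "pullback_attractor I U F A"
    by (simp add: pullback_attractor_def)
qed

end

theory Submission
  imports Defs
begin

text \<open>
  Upper semicontinuity is obtained at each time \<open>\<tau>\<close> separately; a bounded set of integers
  is finite, so pointwise convergence is then automatically uniform.

  At a fixed \<open>\<tau>\<close> the idea is to start all attractors far enough in the past. The union of all
  \<open>A n\<close> up to time \<open>\<tau>\<close> is one bounded nonautonomous set, so the limit system pulls all of it
  close to \<open>fiber (A 0) \<tau>\<close> after some number \<open>s\<close> of steps, and this \<open>s\<close> does not depend on
  \<open>n\<close>. With \<open>s\<close> fixed, the starting points at time \<open>\<tau> - s\<close> lie in one compact set, on which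
  the \<open>s\<close>-step solutions of the perturbed systems converge uniformly to that of the limit
  system. Finally, by invariance every point of \<open>fiber (A n) \<tau>\<close> is the endpoint of an \<open>s\<close>-step
  solution of system \<open>n\<close> that starts in \<open>fiber (A n) (\<tau> - s)\<close>
  (\<open>general_solution_image_invariant\<close>). The triangle inequality through the solution of the limit
  system with the same starting point gives the estimate (\<open>eventually_semidist_le\<close>).
\<close>

lemma discrete_interval_downward_closed:
  assumes "discrete_interval I" "\<not> bdd_below I" "\<tau> \<in> I" "t \<le> \<tau>"
  shows "t \<in> I"
proof -
  obtain J :: "real set" where J: "is_interval J" "I = {t. real_of_int t \<in> J}"
    using assms(1) unfolding discrete_interval_def by blast
  obtain r where r: "r \<in> I" "r < t"
    using assms(2) by (meson bdd_below.I not_le_imp_less)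
  have "real_of_int r \<in> J" "real_of_int \<tau> \<in> J" using J(2) r(1) assms(3) by simp_all
  moreover have "real_of_int r \<le> real_of_int t" "real_of_int t \<le> real_of_int \<tau>"
    using r(2) assms(4) by simp_all
  ultimately have "real_of_int t \<in> J" using J(1) by (meson is_interval_1)
  then show ?thesis using J by simp
qed

lemma general_solution_self: "general_solution F t t u = u"
  by (simp add: general_solution_def)

lemma general_solution_first_step:
  assumes "r < t"
  shows "general_solution F t r u = general_solution F t (r + 1) (F r u)"
  using assms by (simp add: general_solution_def upto_rec1)

text \<open>
  Invariance is assumed for single steps; the induction prepends steps at the starting time
  because \<open>general_solution\<close> applies the map of that time first.
\<close>

lemma general_solution_image_invariant:
  assumes inv: "na_invariant I F A" and sub: "{\<tau> - int s..\<tau>} \<subseteq> I"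
  shows "general_solution F \<tau> (\<tau> - int s) ` fiber A (\<tau> - int s) = fiber A \<tau>"
  using sub
proof (induction s)
  case 0
  then show ?case by (simp add: general_solution_self)
next
  case (Suc s)
  let ?r = "\<tau> - int (Suc s)"
  have r1: "?r + 1 = \<tau> - int s" by simp
  have "?r \<in> I" "?r + 1 \<in> I" using Suc.prems by auto
  then have "F ?r ` fiber A ?r = fiber A (?r + 1)"
    using inv by (simp add: na_invariant_def shifted_def)
  moreover have "general_solution F \<tau> ?r = general_solution F \<tau> (?r + 1) \<circ> F ?r"
    by (rule ext, unfold o_apply, rule general_solution_first_step) simp
  ultimately have "general_solution F \<tau> ?r ` fiber A ?r
      = general_solution F \<tau> (?r + 1) ` fiber A (?r + 1)"
    by (simp only: image_comp [symmetric])
  also have "\<dots> = fiber A \<tau>"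
    unfolding r1 using Suc.prems by (intro Suc.IH) auto
  finally show ?case .
qed

lemma semidist_leI:
  assumes "\<And>a. a \<in> A \<Longrightarrow> \<exists>b\<in>B. dist a b \<le> e"
  shows "semidist A B \<le> ennreal e"
  unfolding semidist_def
proof (rule SUP_least)
  fix a assume "a \<in> A"
  then obtain b where "b \<in> B" "dist a b \<le> e" using assms by blast
  then show "(INF b\<in>B. ennreal (dist a b)) \<le> ennreal e" by (intro INF_lower2 ennreal_leI)
qed

lemma semidist_lessD:
  assumes "semidist A B < ennreal e" "a \<in> A"
  shows "\<exists>b\<in>B. dist a b < e"
proof -
  have "(INF b\<in>B. ennreal (dist a b)) < ennreal e"
    using assms(1) SUP_upper[OF assms(2)] unfolding semidist_def by (rule le_less_trans[rotated])
  then show ?thesis by (auto simp: INF_less_iff ennreal_less_iff)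
qed

text \<open>
  The estimate at one time \<open>\<tau>\<close>, in the form in which it combines with a finite set of times. The
  index \<open>0\<close> plays the role of the limit system, and closeness of the solutions is only asked for
  on compact sets of starting points, which is why the fibers at each fixed time have to lie in
  a common compact set.
\<close>

lemma eventually_semidist_le:
  fixes A :: "nat \<Rightarrow> (int \<times> 'a::metric_space) set"
  assumes past: "{..\<tau>} \<subseteq> I"
    and attracts: "\<And>B. B \<subseteq> Sigma I U \<Longrightarrow> na_bounded I B \<Longrightarrow> pullback_attracts I (F 0) (A 0) B"
    and inv: "\<And>n. na_invariant I (F n) (A n)"
    and sub: "\<And>n. A n \<subseteq> Sigma I U"
    and cpt: "\<And>t. t \<le> \<tau> \<Longrightarrow> compact (closure (\<Union>n. fiber (A n) t))"
    and bdd: "bounded (\<Union>n. \<Union>t\<in>{..\<tau>}. fiber (A n) t)"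
    and close: "\<And>(\<delta>::real) s K. \<delta> > 0 \<Longrightarrow> s \<ge> 1 \<Longrightarrow> compact K \<Longrightarrow>
      \<forall>\<^sub>F n in sequentially. \<forall>u\<in>U (\<tau> - int s) \<inter> K.
        dist (general_solution (F n) \<tau> (\<tau> - int s) u)
             (general_solution (F 0) \<tau> (\<tau> - int s) u) < \<delta>"
    and "\<epsilon> > 0"
  shows "\<forall>\<^sub>F n in sequentially. semidist (fiber (A n) \<tau>) (fiber (A 0) \<tau>) \<le> ennreal \<epsilon>"
proof -
  \<comment> \<open>The fibers after \<open>\<tau>\<close> are cut off since boundedness is only known for the past; pullback
    attraction at \<open>\<tau>\<close> does not see them.\<close>
  define B where "B = (\<Union>n. A n) \<inter> {..\<tau>} \<times> UNIV"
  have "B \<subseteq> Sigma I U" using sub by (auto simp: B_def)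
  moreover have "na_bounded I B"
  proof -
    obtain x R where R: "R > 0" "(\<Union>n. \<Union>t\<in>{..\<tau>}. fiber (A n) t) \<subseteq> ball x R"
      using bdd by (metis bounded_subset_ballD)
    then have "\<forall>t\<in>I. fiber B t \<subseteq> ball x R" by (auto simp: B_def fiber_def)
    with R(1) show ?thesis unfolding na_bounded_def by blast
  qed
  moreover have "\<tau> \<in> I" using past by auto
  ultimately have "((\<lambda>s::int. semidist (general_solution (F 0) \<tau> (\<tau> - s) ` fiber B (\<tau> - s))
      (fiber (A 0) \<tau>)) \<longlongrightarrow> 0) at_top"
    using attracts[of B] by (simp add: pullback_attracts_def)
  moreover have "(0::ennreal) < ennreal (\<epsilon> / 2)" using \<open>\<epsilon> > 0\<close> by simp
  ultimately have "\<forall>\<^sub>F s::int in at_top. semidist (general_solution (F 0) \<tau> (\<tau> - s) `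
      fiber B (\<tau> - s)) (fiber (A 0) \<tau>) < ennreal (\<epsilon> / 2)"
    by (rule order_tendstoD(2))
  then obtain s0 :: int where s0: "\<And>s. s \<ge> s0 \<Longrightarrow> semidist (general_solution (F 0) \<tau> (\<tau> - s) `
      fiber B (\<tau> - s)) (fiber (A 0) \<tau>) < ennreal (\<epsilon> / 2)"
    by (auto simp: eventually_at_top_linorder)
  define s where "s = nat (max s0 1)"
  have s: "s \<ge> 1" "int s \<ge> s0" by (auto simp: s_def)
  let ?r = "\<tau> - int s"
  have pulled: "semidist (general_solution (F 0) \<tau> ?r ` fiber B ?r) (fiber (A 0) \<tau>)
      < ennreal (\<epsilon> / 2)"
    by (rule s0) (rule s(2))
  have "compact (closure (\<Union>n. fiber (A n) ?r))" by (rule cpt) simp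
  with \<open>\<epsilon> > 0\<close> s(1) have "\<forall>\<^sub>F n in sequentially.
      \<forall>u\<in>U ?r \<inter> closure (\<Union>n. fiber (A n) ?r).
        dist (general_solution (F n) \<tau> ?r u) (general_solution (F 0) \<tau> ?r u) < \<epsilon> / 2"
    by (intro close) auto
  then show ?thesis
  proof eventually_elim
    case (elim n)
    show ?case
    proof (rule semidist_leI)
      fix x assume "x \<in> fiber (A n) \<tau>"
      moreover have "{?r..\<tau>} \<subseteq> I" using past by auto
      ultimately obtain u where u: "u \<in> fiber (A n) ?r" "x = general_solution (F n) \<tau> ?r u"
        using general_solution_image_invariant[OF inv] by blast
      let ?y = "general_solution (F 0) \<tau> ?r u"
      have "u \<in> U ?r" using sub[of n] u(1) by (auto simp: fiber_def)
      moreover have "u \<in> closure (\<Union>n. fiber (A n) ?r)"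
        by (rule subsetD[OF closure_subset]) (use u(1) in blast)
      ultimately have "dist x ?y < \<epsilon> / 2" using elim u(2) by blast
      moreover have "u \<in> fiber B ?r" using u(1) by (auto simp: B_def fiber_def)
      then obtain b where "b \<in> fiber (A 0) \<tau>" "dist ?y b < \<epsilon> / 2"
        using semidist_lessD[OF pulled] by blast
      ultimately show "\<exists>b\<in>fiber (A 0) \<tau>. dist x b \<le> \<epsilon>"
        using dist_triangle_half_r[of ?y x \<epsilon> b] by (auto simp: dist_commute intro: less_imp_le)
    qed
  qed
qed

theorem theorem2p6:
  fixes I :: "int set"
    and U :: "int \<Rightarrow> 'a::complete_space set"
    and F :: "nat \<Rightarrow> int \<Rightarrow> 'a \<Rightarrow> 'a"
    and A :: "nat \<Rightarrow> (int \<times> 'a) set"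
  assumes interval: "discrete_interval I" "\<not> bdd_below I"
    and U: "\<And>t. t \<in> I \<Longrightarrow> U t \<noteq> {} \<and> closed (U t)"
    and F_cont: "\<And>n t. t \<in> shifted I \<Longrightarrow> continuous_on (U t) (F n t)"
    and F_maps: "\<And>n t. t \<in> shifted I \<Longrightarrow> F n t ` U t \<subseteq> U (t + 1)"
    and attractor: "\<And>n. pullback_attractor I U (F n) (A n)"
    and i: "\<And>\<tau>. \<tau> \<in> I \<Longrightarrow> compact (closure (\<Union>n. fiber (A n) \<tau>))"
    and ii: "\<And>\<tau>. \<tau> \<in> I \<Longrightarrow> bounded (\<Union>n. \<Union>s\<in>{..\<tau>}. fiber (A n) s)"
    and iii: "\<And>(\<epsilon>::real) (S::nat) (K::'a set). \<epsilon> > 0 \<Longrightarrow> S \<ge> 1 \<Longrightarrow> compact K \<Longrightarrow>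
      \<exists>n0\<ge>1. \<forall>\<tau>\<in>I. \<forall>n>n0.
        (MAX s\<in>{0<..int S}. SUP u\<in>U (\<tau> - s) \<inter> K.
           ennreal (dist (general_solution (F n) \<tau> (\<tau> - s) u)
                         (general_solution (F 0) \<tau> (\<tau> - s) u))) < ennreal \<epsilon>"
  shows "\<forall>J. J \<subseteq> I \<and> bdd_below J \<and> bdd_above J \<longrightarrow>
    (\<lambda>n. SUP t\<in>J. semidist (fiber (A n) t) (fiber (A 0) t)) \<longlonglongrightarrow> 0"
proof (intro allI impI)
  fix J assume J: "J \<subseteq> I \<and> bdd_below J \<and> bdd_above J"
  then obtain a b where "J \<subseteq> {a..b}"
    unfolding bdd_below_def bdd_above_def by (meson atLeastAtMost_iff subsetI)
  then have fin: "finite J" using finite_subset by blast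
  have "A n \<subseteq> Sigma I U" "na_invariant I (F n) (A n)" for n
    using attractor[of n] by (auto simp: pullback_attractor_def nonautonomous_set_def)
  moreover have "pullback_attracts I (F 0) (A 0) B" if "B \<subseteq> Sigma I U" "na_bounded I B" for B
    using attractor[of 0] that by (simp add: pullback_attractor_def)
  moreover have close: "\<forall>\<^sub>F n in sequentially. \<forall>u\<in>U (\<tau> - int s) \<inter> K.
        dist (general_solution (F n) \<tau> (\<tau> - int s) u)
             (general_solution (F 0) \<tau> (\<tau> - int s) u) < \<delta>"
    if \<tau>: "\<tau> \<in> I" and prems: "\<delta> > 0" "s \<ge> 1" "compact K" for \<tau> \<delta> s K
  proof -
    let ?d = "\<lambda>n (s::int) u. ennreal (dist (general_solution (F n) \<tau> (\<tau> - s) u)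
      (general_solution (F 0) \<tau> (\<tau> - s) u))"
    obtain n0 where n0: "\<And>n. n > n0 \<Longrightarrow>
        (MAX s\<in>{0<..int s}. SUP u\<in>U (\<tau> - s) \<inter> K. ?d n s u) < ennreal \<delta>"
      using iii[OF prems] \<tau> by blast
    show ?thesis
    proof (rule eventually_mono[OF eventually_gt_at_top[of n0]], rule ballI)
      fix n u assume "n > n0" and u: "u \<in> U (\<tau> - int s) \<inter> K"
      have "?d n (int s) u \<le> (SUP u\<in>U (\<tau> - int s) \<inter> K. ?d n (int s) u)"
        using u by (rule SUP_upper)
      also have "\<dots> \<le> (MAX s\<in>{0<..int s}. SUP u\<in>U (\<tau> - s) \<inter> K. ?d n s u)"
        using prems(2) by (intro Max_ge) auto
      also have "\<dots> < ennreal \<delta>" using n0 \<open>n > n0\<close> .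
      finally show "dist (general_solution (F n) \<tau> (\<tau> - int s) u)
          (general_solution (F 0) \<tau> (\<tau> - int s) u) < \<delta>"
        by (simp add: ennreal_less_iff)
    qed
  qed
  moreover have past: "t \<in> I" if "\<tau> \<in> I" "t \<le> \<tau>" for t \<tau>
    using discrete_interval_downward_closed[OF interval that] .
  ultimately have pointwise: "\<forall>\<^sub>F n in sequentially.
      semidist (fiber (A n) t) (fiber (A 0) t) \<le> ennreal \<epsilon>" if "t \<in> I" "\<epsilon> > 0" for t \<epsilon>
    using that by (intro eventually_semidist_le[of t I U F A \<epsilon>] i ii close) (auto intro: past)
  show "(\<lambda>n. SUP t\<in>J. semidist (fiber (A n) t) (fiber (A 0) t)) \<longlonglongrightarrow> 0"
  proof (rule order_tendstoI)
    fix e :: ennreal assume "0 < e"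
    then obtain c where c: "0 < c" "c < e" using dense by blast
    then obtain \<epsilon> where \<epsilon>: "\<epsilon> > 0" "ennreal \<epsilon> < e"
      by (cases c) auto
    have "\<forall>\<^sub>F n in sequentially. \<forall>t\<in>J. semidist (fiber (A n) t) (fiber (A 0) t) \<le> ennreal \<epsilon>"
      using fin J \<epsilon>(1) by (intro eventually_ball_finite ballI pointwise) auto
    then show "\<forall>\<^sub>F n in sequentially. (SUP t\<in>J. semidist (fiber (A n) t) (fiber (A 0) t)) < e"
    proof eventually_elim
      case (elim n)
      then have "(SUP t\<in>J. semidist (fiber (A n) t) (fiber (A 0) t)) \<le> ennreal \<epsilon>"
        by (intro SUP_least) auto
      then show ?case using \<epsilon>(2) by (rule le_less_trans)
    qed
  qed simp
qed

end
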